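(* Consider the autonomous system on $\mathbb{R}^5$ with real parameters $C,D,E,F$ $$ \begin{aligned} \dot y_1 &= Cy_1-\big[y_3+\tfrac18(y_1^2+y_2^2+y_4^2+y_5^2)\big]y_2-\tfrac34(y_1y_5-y_2y_4)y_4+2y_2,\\ \dot y_2 &= Cy_2+\big[y_3+\tfrac18(y_1^2+y_2^2+y_4^2+y_5^2)\big]y_1-\tfrac34(y_1y_5-y_2y_4)y_5+2y_1,\\ \dot y_3 &= D(y_1y_2+y_4y_5)+Ey_3+F,\\ \dot y_4 &= Cy_4-\big[y_3+\tfrac18(y_1^2+y_2^2+y_4^2+y_5^2)\big]y_5+\tfrac34(y_1y_5-y_2y_4)y_1+2y_5,\\ \dot y_5 &= Cy_5+\big[y_3+\tfrac18(y_1^2+y_2^2+y_4^2+y_5^2)\big]y_4+\tfrac34(y_1y_5-y_2y_4)y_2+2y_4. \end{aligned} $$ Let $L$ be a limit set of this system. Then any point $\mathbf{y}_0=(y_{10},y_{20},y_{30},y_{40},y_{50})\in L$ and its solution $\mathbf{y}(t,\mathbf{y}_0)=(y_1(t),y_2(t),y_3(t),y_4(t),y_5(t))$, i.e. the solution starting from $\mathbf{y}_0$ at $t=0$, satisfy $$ y_{40}\,y_1(t)-y_{10}\,y_4(t)=0,\qquad y_{50}\,y_2(t)-y_{20}\,y_5(t)=0 . $$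
   Context: The system is the averaged model of a spherical pendulum driven by a limited-power electric motor; $C,D,E,F$ are parameters determined by physical and geometric characteristics of the pendulum and the motor ($C$ is a damping parameter). The dot denotes $d/dt$. "Limit set" is understood in the standard sense of the $\omega$-limit set of a solution: for a solution $\mathbf{y}(t)$, $t\ge 0$, it is the set of all points $\mathbf{p}\in\mathbb{R}^5$ such that $\mathbf{y}(t_n)\to\mathbf{p}$ for some sequence $t_n\to+\infty$.
   Formalization: The formal theorem assumes C ≠ 0; for C = 0 the claim is false (e.g. C=D=E=F=0 has periodic orbits where (y1,y4) and (y2,y5) rotate uniformly, violating the first identity). *)

theory Defs
  imports "HOL-Analysis.Analysis"
begin

text \<open>Right-hand side of the averaged pendulum--motor system. In the index type \<open>5\<close> the
  numeral \<open>5\<close> denotes the same element as \<open>0\<close>; the indices \<open>1, \<dots>, 5\<close> are the five distinct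
  elements of that type.\<close>

definition pendulum_field :: "real \<Rightarrow> real \<Rightarrow> real \<Rightarrow> real \<Rightarrow> real ^ 5 \<Rightarrow> real ^ 5" where
  "pendulum_field C D E F y =
    (let A = y$3 + 1/8 * ((y$1)\<^sup>2 + (y$2)\<^sup>2 + (y$4)\<^sup>2 + (y$5)\<^sup>2);
         M = y$1 * y$5 - y$2 * y$4
     in vector
       [C * y$1 - A * y$2 - 3/4 * M * y$4 + 2 * y$2,
        C * y$2 + A * y$1 - 3/4 * M * y$5 + 2 * y$1,
        D * (y$1 * y$2 + y$4 * y$5) + E * y$3 + F,
        C * y$4 - A * y$5 + 3/4 * M * y$1 + 2 * y$5,
        C * y$5 + A * y$4 + 3/4 * M * y$2 + 2 * y$4])"

lemma vector_5_nth:
  "(vector [a, b, c, d, e] :: 'a::zero ^ 5) $ 1 = a"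
  "(vector [a, b, c, d, e] :: 'a::zero ^ 5) $ 2 = b"
  "(vector [a, b, c, d, e] :: 'a::zero ^ 5) $ 3 = c"
  "(vector [a, b, c, d, e] :: 'a::zero ^ 5) $ 4 = d"
  "(vector [a, b, c, d, e] :: 'a::zero ^ 5) $ 5 = e"
  unfolding vector_def by simp_all

text \<open>At the endpoints of the time set \<open>T\<close> the derivative is one-sided.\<close>

definition solution_on ::
  "('a::real_normed_vector \<Rightarrow> 'a) \<Rightarrow> real set \<Rightarrow> (real \<Rightarrow> 'a) \<Rightarrow> bool" where
  "solution_on f T y \<longleftrightarrow> (\<forall>t\<in>T. (y has_vector_derivative f (y t)) (at t within T))"

definition omega_limit :: "(real \<Rightarrow> 'a::topological_space) \<Rightarrow> 'a set" where
  "omega_limit y =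
    {p. \<exists>s. (\<forall>n. 0 \<le> s n) \<and> filterlim s at_top sequentially \<and> (\<lambda>n. y (s n)) \<longlonglongrightarrow> p}"

definition limit_set_of :: "('a::real_normed_vector \<Rightarrow> 'a) \<Rightarrow> 'a set \<Rightarrow> bool" where
  "limit_set_of f L \<longleftrightarrow> (\<exists>y. solution_on f {0..} y \<and> L = omega_limit y)"

end

theory Submission
  imports Defs
begin

text \<open>
  Write \<open>v = (y\<^sub>1, y\<^sub>2)\<close> and \<open>w = (y\<^sub>4, y\<^sub>5)\<close>. The determinant \<open>M = y\<^sub>1 y\<^sub>5 - y\<^sub>2 y\<^sub>4\<close> of these
  two vectors obeys the scalar linear equation \<open>M' = 2 C M\<close>, so along every solution it is a
  multiple of \<open>exp (2 C t)\<close>. For \<open>C < 0\<close> it decays; for \<open>C > 0\<close> it either is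
  identically zero or leaves every bounded set, and in the latter case the solution has no limit
  points. Either way \<open>M\<close> vanishes on the limit set (\<open>cross_det_omega_limit\<close>), which says that
  \<open>v\<close> and \<open>w\<close> are parallel there.

  On a solution that starts at a point with \<open>M = 0\<close> the terms containing \<open>M\<close> drop out, and \<open>v\<close> and
  \<open>w\<close> satisfy one and the same linear planar system \<open>z' = B(t) z\<close>, whose coefficients depend on the
  solution through \<open>A = y\<^sub>3 + (|v|\<^sup>2 + |w|\<^sup>2) / 8\<close> only. A linear relation \<open>a v + b w = 0\<close> at time
  \<open>0\<close> therefore persists (\<open>linear_relation_persists\<close>). Since \<open>A\<close> enters \<open>B\<close> skew-symmetrically, it
  cancels in the derivative of \<open>|z|\<^sup>2\<close>, and uniqueness for this system needs no bound
  on \<open>A\<close>. The two claimed identities are the first coordinate of the relation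
  \<open>y\<^sub>4\<^sub>0 v - y\<^sub>1\<^sub>0 w = 0\<close> and the second coordinate of \<open>y\<^sub>5\<^sub>0 v - y\<^sub>2\<^sub>0 w = 0\<close>; both relations hold
  at time \<open>0\<close> because \<open>M\<close> vanishes there.
\<close>

lemma linear_scalar_ode_solution:
  fixes f :: "real \<Rightarrow> real"
  assumes T: "is_interval T" "0 \<in> T" "t \<in> T"
    and deriv: "\<And>x. x \<in> T \<Longrightarrow> (f has_real_derivative k * f x) (at x within T)"
  shows "f t = f 0 * exp (k * t)"
proof -
  have "((\<lambda>x. f x * exp (- k * x)) has_real_derivative 0) (at x within T)" if "x \<in> T" for x
  proof -
    have "((\<lambda>x. exp (- k * x)) has_real_derivative - k * exp (- k * x)) (at x within T)"
      by (auto intro!: derivative_eq_intros)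
    from DERIV_mult[OF deriv[OF that] this] show ?thesis
      by (simp add: algebra_simps)
  qed
  then obtain c where c: "\<And>x. x \<in> T \<Longrightarrow> f x * exp (- k * x) = c"
    using has_field_derivative_zero_constant[of T "\<lambda>x. f x * exp (- k * x)"]
      T(1)[unfolded is_interval_convex_1] by blast
  have "f t * exp (- k * t) = f 0"
    using c[OF \<open>0 \<in> T\<close>] c[OF \<open>t \<in> T\<close>] by simp
  then show ?thesis
    by (simp add: exp_minus field_simps)
qed

text \<open>
  The two-sided bound on the derivative makes \<open>f t exp (- K t)\<close> nonincreasing and \<open>f t exp (K t)\<close>
  nondecreasing; the first controls \<open>f\<close> after time \<open>0\<close> and the second before it.
\<close>

lemma gronwall_zero:
  fixes f f' :: "real \<Rightarrow> real"
  assumes T: "is_interval T" "0 \<in> T" "t \<in> T"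
    and deriv: "\<And>x. x \<in> T \<Longrightarrow> (f has_real_derivative f' x) (at x within T)"
    and bound: "\<And>x. x \<in> T \<Longrightarrow> \<bar>f' x\<bar> \<le> K * f x"
    and nonneg: "f t \<ge> 0" and zero: "f 0 = 0"
  shows "f t = 0"
proof -
  have weighted: "((\<lambda>x. f x * exp (k * x)) has_real_derivative (f' x + k * f x) * exp (k * x))
      (at x within S)" if "x \<in> S" "S \<subseteq> T" for x k S
  proof -
    have "((\<lambda>x. exp (k * x)) has_real_derivative k * exp (k * x)) (at x within S)"
      by (auto intro!: derivative_eq_intros)
    from DERIV_mult[OF DERIV_subset[OF deriv[of x]] this] that show ?thesis
      by (auto simp: algebra_simps)
  qed
  have "f t \<le> 0"
  proof (cases t "0::real" rule: linorder_cases)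
    case greater
    have sub: "{0..t} \<subseteq> T"
      using mem_is_interval_1_I[OF T] by auto
    obtain x where x: "x \<in> {0<..<t}"
      "f t * exp (-K * t) - f 0 * exp (-K * 0) = (f' x + -K * f x) * exp (-K * x) * (t - 0)"
      using mvt_simple[OF greater, of "\<lambda>x. f x * exp (-K * x)"
          "\<lambda>x h. (f' x + -K * f x) * exp (-K * x) * h"]
        weighted[OF _ sub, of _ "-K"]
      unfolding has_field_derivative_def atLeastAtMost_iff by blast
    have "x \<in> T" using x(1) sub by auto
    then have "f' x + -K * f x \<le> 0" using bound[of x] by linarith
    then have "(f' x + -K * f x) * exp (-K * x) * (t - 0) \<le> 0"
      using greater by (intro mult_nonpos_nonneg) auto
    then have "f t * exp (-K * t) \<le> 0" using x(2) zero by simp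
    then show ?thesis by (simp add: mult_le_0_iff)
  next
    case less
    have sub: "{t..0} \<subseteq> T"
      using mem_is_interval_1_I[OF T(1,3,2)] by auto
    obtain x where x: "x \<in> {t<..<0}"
      "f 0 * exp (K * 0) - f t * exp (K * t) = (f' x + K * f x) * exp (K * x) * (0 - t)"
      using mvt_simple[OF less, of "\<lambda>x. f x * exp (K * x)"
          "\<lambda>x h. (f' x + K * f x) * exp (K * x) * h"]
        weighted[OF _ sub, of _ K]
      unfolding has_field_derivative_def atLeastAtMost_iff by blast
    have "x \<in> T" using x(1) sub by auto
    then have "f' x + K * f x \<ge> 0" using bound[of x] by linarith
    then have "(f' x + K * f x) * exp (K * x) * (0 - t) \<ge> 0"
      using less by (intro mult_nonneg_nonneg) auto
    then have "f t * exp (K * t) \<le> 0" using x(2) zero by simp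
    then show ?thesis by (simp add: mult_le_0_iff)
  qed (use zero in simp)
  with nonneg show ?thesis by simp
qed

definition cross_det :: "real ^ 5 \<Rightarrow> real" where
  "cross_det y = y$1 * y$5 - y$2 * y$4"

definition frequency :: "real ^ 5 \<Rightarrow> real" where
  "frequency y = y$3 + 1/8 * ((y$1)\<^sup>2 + (y$2)\<^sup>2 + (y$4)\<^sup>2 + (y$5)\<^sup>2)"

lemma pendulum_solution_components:
  assumes "solution_on (pendulum_field C D E F) T y" "t \<in> T"
  defines "A \<equiv> frequency (y t)" and "M \<equiv> cross_det (y t)"
  shows
    "((\<lambda>t. y t $ 1) has_real_derivative
       C * y t$1 - A * y t$2 - 3/4 * M * y t$4 + 2 * y t$2) (at t within T)"
    "((\<lambda>t. y t $ 2) has_real_derivative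
       C * y t$2 + A * y t$1 - 3/4 * M * y t$5 + 2 * y t$1) (at t within T)"
    "((\<lambda>t. y t $ 4) has_real_derivative
       C * y t$4 - A * y t$5 + 3/4 * M * y t$1 + 2 * y t$5) (at t within T)"
    "((\<lambda>t. y t $ 5) has_real_derivative
       C * y t$5 + A * y t$4 + 3/4 * M * y t$2 + 2 * y t$4) (at t within T)"
proof -
  have "((\<lambda>t. y t $ i) has_real_derivative pendulum_field C D E F (y t) $ i) (at t within T)" for i
    using bounded_linear.has_vector_derivative[OF bounded_linear_vec_nth, of y _ _ i] assms(1,2)
    by (auto simp: solution_on_def has_real_derivative_iff_has_vector_derivative)
  from this[of 1] this[of 2] this[of 4] this[of 5] show
    "((\<lambda>t. y t $ 1) has_real_derivative
       C * y t$1 - A * y t$2 - 3/4 * M * y t$4 + 2 * y t$2) (at t within T)"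
    "((\<lambda>t. y t $ 2) has_real_derivative
       C * y t$2 + A * y t$1 - 3/4 * M * y t$5 + 2 * y t$1) (at t within T)"
    "((\<lambda>t. y t $ 4) has_real_derivative
       C * y t$4 - A * y t$5 + 3/4 * M * y t$1 + 2 * y t$5) (at t within T)"
    "((\<lambda>t. y t $ 5) has_real_derivative
       C * y t$5 + A * y t$4 + 3/4 * M * y t$2 + 2 * y t$4) (at t within T)"
    unfolding pendulum_field_def A_def M_def frequency_def cross_det_def Let_def vector_5_nth
    by simp_all
qed

text \<open>
  The rotation by \<open>A\<close> is the same in both planes and preserves the determinant, the
  contributions of the terms with factor \<open>M\<close> and with factor \<open>2\<close> cancel in pairs, and only the damping \<open>C\<close> acts, once on each
  factor.
\<close>

lemma cross_det_along_solution:
  assumes "solution_on (pendulum_field C D E F) T y" "is_interval T" "0 \<in> T" "t \<in> T"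
  shows "cross_det (y t) = cross_det (y 0) * exp (2 * C * t)"
proof (rule linear_scalar_ode_solution[OF assms(2-4)])
  fix x assume "x \<in> T"
  note comps = pendulum_solution_components[OF assms(1) this]
  have "((\<lambda>t. y t $ 1 * y t $ 5 - y t $ 2 * y t $ 4) has_real_derivative
      2 * C * (y x $ 1 * y x $ 5 - y x $ 2 * y x $ 4)) (at x within T)"
    by (rule derivative_eq_intros comps refl)+ (simp add: algebra_simps)
  then show "((\<lambda>t. cross_det (y t)) has_real_derivative 2 * C * cross_det (y x)) (at x within T)"
    by (simp add: cross_det_def)
qed

lemma cross_det_omega_limit:
  assumes "C \<noteq> 0" "solution_on (pendulum_field C D E F) {0..} u" "p \<in> omega_limit u"
  shows "cross_det p = 0"
proof -
  obtain s where s: "\<And>n. 0 \<le> s n" "filterlim s at_top sequentially" "(\<lambda>n. u (s n)) \<longlonglongrightarrow> p"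
    using assms(3) by (auto simp: omega_limit_def)
  have growth: "cross_det (u (s n)) = cross_det (u 0) * exp (2 * C * s n)" for n
    by (rule cross_det_along_solution[OF assms(2)]) (use s in \<open>simp_all add: is_interval_ci\<close>)
  have lim: "(\<lambda>n. cross_det (u (s n))) \<longlonglongrightarrow> cross_det p"
    unfolding cross_det_def by (intro tendsto_intros s)
  have decay: "(\<lambda>n. exp (- (c * s n))) \<longlonglongrightarrow> 0" if "c > 0" for c
    using filterlim_tendsto_pos_mult_at_top[OF tendsto_const that s(2)]
    by (intro filterlim_compose[OF exp_at_bot]) (simp add: filterlim_uminus_at_bot)
  show ?thesis
  proof (cases "C < 0")
    case True
    have "(\<lambda>n. cross_det (u 0) * exp (- (- 2 * C * s n))) \<longlonglongrightarrow> cross_det (u 0) * 0"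
      using True by (intro tendsto_intros decay) simp
    then show ?thesis
      using LIMSEQ_unique[OF lim] by (simp add: growth)
  next
    case False
    \<comment> \<open>Here the growth law is read backwards: convergence along \<open>s\<close> forces the initial determinant
      to vanish, hence all later ones.\<close>
    have "(\<lambda>n. cross_det (u (s n)) * exp (- (2 * C * s n))) \<longlonglongrightarrow> cross_det p * 0"
      using False assms(1) by (intro tendsto_intros decay lim) simp
    moreover have "cross_det (u (s n)) * exp (- (2 * C * s n)) = cross_det (u 0)" for n
      by (simp add: growth exp_minus)
    ultimately have "cross_det (u 0) = 0"
      by (simp add: LIMSEQ_const_iff)
    then show ?thesis
      using lim by (simp add: growth LIMSEQ_const_iff)
  qed
qed

text \<open>
  With \<open>M = 0\<close> and \<open>z = a v + b w\<close> the energy \<open>|z|\<^sup>2\<close> has derivative \<open>2 C |z|\<^sup>2 + 8 z\<^sub>1 z\<^sub>2\<close>, because the rotation by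
  \<open>A\<close> does not change lengths. Its modulus is at most \<open>(2 |C| + 4) |z|\<^sup>2\<close>, so the energy stays zero.
\<close>

lemma linear_relation_persists:
  fixes a b :: real
  assumes sol: "solution_on (pendulum_field C D E F) T y"
    and T: "is_interval T" "0 \<in> T" "t \<in> T"
    and det: "cross_det (y 0) = 0"
    and init: "a * y 0 $ 1 + b * y 0 $ 4 = 0" "a * y 0 $ 2 + b * y 0 $ 5 = 0"
  shows "a * y t $ 1 + b * y t $ 4 = 0" "a * y t $ 2 + b * y t $ 5 = 0"
proof -
  define z1 where "z1 = (\<lambda>t. a * y t $ 1 + b * y t $ 4)"
  define z2 where "z2 = (\<lambda>t. a * y t $ 2 + b * y t $ 5)"
  have det0: "cross_det (y x) = 0" if "x \<in> T" for x
    using cross_det_along_solution[OF sol T(1,2) that] det by simp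
  have "(z1 t)\<^sup>2 + (z2 t)\<^sup>2 = 0"
  proof (rule gronwall_zero[OF T, where f = "\<lambda>t. (z1 t)\<^sup>2 + (z2 t)\<^sup>2"
        and f' = "\<lambda>t. 2 * C * ((z1 t)\<^sup>2 + (z2 t)\<^sup>2) + 8 * z1 t * z2 t" and K = "2 * \<bar>C\<bar> + 4"])
    fix x assume "x \<in> T"
    note comps = pendulum_solution_components[OF sol \<open>x \<in> T\<close>, unfolded det0[OF \<open>x \<in> T\<close>]]
    define A where "A = frequency (y x)"
    have "(z1 has_real_derivative C * z1 x - A * z2 x + 2 * z2 x) (at x within T)"
      unfolding z1_def z2_def A_def
      by (rule derivative_eq_intros comps refl)+ (simp add: algebra_simps)
    moreover have "(z2 has_real_derivative C * z2 x + A * z1 x + 2 * z1 x) (at x within T)"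
      unfolding z1_def z2_def A_def
      by (rule derivative_eq_intros comps refl)+ (simp add: algebra_simps)
    ultimately show "((\<lambda>t. (z1 t)\<^sup>2 + (z2 t)\<^sup>2) has_real_derivative
        2 * C * ((z1 x)\<^sup>2 + (z2 x)\<^sup>2) + 8 * z1 x * z2 x) (at x within T)"
      by (auto intro!: derivative_eq_intros simp: algebra_simps power2_eq_square)
  next
    fix x
    have "\<bar>2 * C * ((z1 x)\<^sup>2 + (z2 x)\<^sup>2)\<bar> = 2 * \<bar>C\<bar> * ((z1 x)\<^sup>2 + (z2 x)\<^sup>2)"
      by (simp add: abs_mult)
    moreover have "\<bar>8 * z1 x * z2 x\<bar> \<le> 4 * ((z1 x)\<^sup>2 + (z2 x)\<^sup>2)"
      using zero_le_power2[of "z1 x - z2 x"] zero_le_power2[of "z1 x + z2 x"]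
      unfolding power2_diff power2_sum by (simp add: abs_le_iff)
    ultimately show "\<bar>2 * C * ((z1 x)\<^sup>2 + (z2 x)\<^sup>2) + 8 * z1 x * z2 x\<bar>
        \<le> (2 * \<bar>C\<bar> + 4) * ((z1 x)\<^sup>2 + (z2 x)\<^sup>2)"
      by (simp add: distrib_right)
  qed (use init in \<open>simp_all add: z1_def z2_def\<close>)
  then show "a * y t $ 1 + b * y t $ 4 = 0" "a * y t $ 2 + b * y t $ 5 = 0"
    by (simp_all add: sum_power2_eq_zero_iff z1_def z2_def)
qed

theorem theorem4p1:
  fixes C D E F :: real
    and L :: "(real ^ 5) set"
    and y0 :: "real ^ 5"
    and y :: "real \<Rightarrow> real ^ 5"
    and T :: "real set"
  assumes "C \<noteq> 0"
    and "limit_set_of (pendulum_field C D E F) L"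
    and "y0 \<in> L"
    and "is_interval T" and "0 \<in> T"
    and "solution_on (pendulum_field C D E F) T y" and "y 0 = y0"
  shows "\<forall>t\<in>T. y0 $ 4 * y t $ 1 - y0 $ 1 * y t $ 4 = 0 \<and>
               y0 $ 5 * y t $ 2 - y0 $ 2 * y t $ 5 = 0"
proof
  fix t assume "t \<in> T"
  obtain u where "solution_on (pendulum_field C D E F) {0..} u" "L = omega_limit u"
    using assms(2) by (auto simp: limit_set_of_def)
  then have det: "cross_det (y 0) = 0"
    using cross_det_omega_limit[OF assms(1)] assms(3,7) by auto
  then have det': "y0 $ 1 * y0 $ 5 = y0 $ 2 * y0 $ 4"
    using assms(7) by (simp add: cross_det_def)
  note persists = linear_relation_persists[OF assms(6,4,5) \<open>t \<in> T\<close> det]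
  have "y0 $ 4 * y t $ 1 + - y0 $ 1 * y t $ 4 = 0"
    by (rule persists) (use det' assms(7) in \<open>simp_all add: mult.commute\<close>)
  moreover have "y0 $ 5 * y t $ 2 + - y0 $ 2 * y t $ 5 = 0"
    by (rule persists) (use det' assms(7) in \<open>simp_all add: mult.commute\<close>)
  ultimately show "y0 $ 4 * y t $ 1 - y0 $ 1 * y t $ 4 = 0 \<and>
               y0 $ 5 * y t $ 2 - y0 $ 2 * y t $ 5 = 0"
    by simp
qed

end
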